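(* Let $\mathcal H$ be a complex, separable, infinite-dimensional Hilbert space, let $T\in\mathcal B(\mathcal H)$ and let $n\ge2$ be an integer. Suppose that $T$ is $\textsc{j}_n^{[\textsc{au}]}$-stable, i.e. $T$ is approximately unitarily equivalent to $J_n(T)$. Then: (a) $\sigma(T)=\mathbb T$ if $T$ is invertible; and (b) $\sigma(T)=\overline{\mathbb D}$ if $T$ is not invertible.
   Context: $\mathbb T=\{z\in\mathbb C:|z|=1\}$, $\mathbb D=\{z\in\mathbb C:|z|<1\}$; $\sigma(T)$ is the spectrum. For $T\in\mathcal B(\mathcal H)$ and $n\ge2$, $J_n(T)\in\mathcal B(\mathcal H^{(n)})$ (where $\mathcal H^{(n)}$ is the direct sum of $n$ copies of $\mathcal H$) is the $n\times n$ operator matrix with $I$ in each entry $(i,i+1)$, $1\le i\le n-1$, with $T$ in the entry $(n,1)$, and $0$ elsewhere. Operators $X,Y$ on Hilbert spaces are approximately unitarily equivalent if there is a sequence $(V_k)_k$ of unitary operators between the underlying spaces with $Y=\lim_k V_k^*XV_k$ in operator norm. *)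

theory Defs
  imports "HOL-Analysis.Analysis"
begin

section \<open>Complex Hilbert spaces\<close>

text \<open>
  A complex Hilbert space is a complete real inner product space with a compatible complex
  structure: the norm, metric and topology are those of \<^class>\<open>real_inner\<close>, and the real inner
  product is the real part of the complex one, so \<open>norm x = sqrt (Re (cinner x x))\<close>.
  The inner product \<open>cinner\<close> is linear in its first argument.
\<close>

class complex_vector = real_vector +
  fixes scaleC :: "complex \<Rightarrow> 'a \<Rightarrow> 'a"  (infixr \<open>*\<^sub>C\<close> 75)
  assumes scaleC_add_right: "a *\<^sub>C (x + y) = a *\<^sub>C x + a *\<^sub>C y"
    and scaleC_add_left: "(a + b) *\<^sub>C x = a *\<^sub>C x + b *\<^sub>C x"
    and scaleC_scaleC: "a *\<^sub>C (b *\<^sub>C x) = (a * b) *\<^sub>C x"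
    and scaleC_one: "1 *\<^sub>C x = x"
    and scaleR_scaleC: "r *\<^sub>R x = complex_of_real r *\<^sub>C x"

class complex_inner = complex_vector + real_inner +
  fixes cinner :: "'a \<Rightarrow> 'a \<Rightarrow> complex"
  assumes cinner_commute: "cinner x y = cnj (cinner y x)"
    and cinner_add_left: "cinner (x + y) z = cinner x z + cinner y z"
    and cinner_scaleC_left: "cinner (a *\<^sub>C x) y = a * cinner x y"
    and inner_eq_Re_cinner: "inner x y = Re (cinner x y)"

class chilbert_space = complex_inner + complete_space

global_interpretation complex_vector:
  vector_space "scaleC :: complex \<Rightarrow> 'a \<Rightarrow> 'a::complex_vector"
  by unfold_locales
    (simp_all add: scaleC_add_right scaleC_add_left scaleC_scaleC scaleC_one)

lemma cinner_add_right: "cinner x (y + z) = cinner x y + cinner x z"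
  by (metis cinner_add_left cinner_commute complex_cnj_add)

lemma cinner_scaleC_right: "cinner x (a *\<^sub>C y) = cnj a * cinner x y"
  by (metis cinner_scaleC_left cinner_commute complex_cnj_mult)

lemma cinner_eq_all_imp_eq:
  assumes "\<And>x. cinner x y = cinner x z"
  shows "y = z"
proof -
  have "inner x (y - z) = 0" for x
    using assms[of x] inner_eq_Re_cinner[of x y] inner_eq_Re_cinner[of x z]
    by (simp add: inner_diff_right)
  then have "inner (y - z) (y - z) = 0" .
  then show ?thesis by simp
qed

text \<open>\<open>H ^ 'n\<close> is the Hilbert direct sum of \<open>CARD('n)\<close> copies of \<open>H\<close>.\<close>

instantiation vec :: (complex_vector, finite) complex_vector
begin

definition "scaleC a x = (\<chi> i. a *\<^sub>C (x $ i))"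

instance
  by standard
    (simp_all add: scaleC_vec_def vec_eq_iff scaleC_add_right scaleC_add_left scaleC_scaleC
      scaleC_one scaleR_scaleC)

end

instantiation vec :: (complex_inner, finite) complex_inner
begin

definition "cinner x y = (\<Sum>i\<in>UNIV. cinner (x $ i) (y $ i))"

instance
proof
  fix x y z :: "'a ^ 'b" and a :: complex
  show "cinner x y = cnj (cinner y x)"
    unfolding cinner_vec_def cnj_sum by (intro sum.cong refl cinner_commute)
  show "cinner (x + y) z = cinner x z + cinner y z"
    by (simp add: cinner_vec_def cinner_add_left sum.distrib)
  show "cinner (a *\<^sub>C x) y = a * cinner x y"
    by (simp add: cinner_vec_def scaleC_vec_def cinner_scaleC_left sum_distrib_left)
  show "inner x y = Re (cinner x y)"
    by (simp add: cinner_vec_def inner_vec_def inner_eq_Re_cinner)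
qed

end

instance vec :: (chilbert_space, finite) chilbert_space ..


section \<open>Bounded operators\<close>

definition bounded_clinear :: "('a::complex_inner \<Rightarrow> 'b::complex_inner) \<Rightarrow> bool" where
  "bounded_clinear T \<longleftrightarrow>
     Vector_Spaces.linear scaleC scaleC T \<and> (\<exists>K. \<forall>x. norm (T x) \<le> norm x * K)"

definition invertible_op :: "('a::complex_inner \<Rightarrow> 'a) \<Rightarrow> bool" where
  "invertible_op T \<longleftrightarrow> (\<exists>S. bounded_clinear S \<and> S \<circ> T = id \<and> T \<circ> S = id)"

definition op_spectrum :: "('a::complex_inner \<Rightarrow> 'a) \<Rightarrow> complex set" where
  "op_spectrum T = {z. \<not> invertible_op (\<lambda>x. T x - z *\<^sub>C x)}"

definition cadjoint :: "('a::complex_inner \<Rightarrow> 'b::complex_inner) \<Rightarrow> 'b \<Rightarrow> 'a" where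
  "cadjoint T = (THE S. \<forall>x y. cinner (T x) y = cinner x (S y))"

definition unitary_op :: "('a::complex_inner \<Rightarrow> 'b::complex_inner) \<Rightarrow> bool" where
  "unitary_op V \<longleftrightarrow>
     bounded_clinear V \<and> surj V \<and> (\<forall>x y. cinner (V x) (V y) = cinner x y)"

text \<open>
  The unitaries act from the space of \<open>Y\<close> to that of \<open>X\<close>. The relation is meant for bounded
  \<open>X\<close> and \<open>Y\<close>; \<open>onorm\<close> is then applied to a bounded operator and is its operator norm.
\<close>

definition approx_unitarily_equiv ::
    "('a::chilbert_space \<Rightarrow> 'a) \<Rightarrow> ('b::chilbert_space \<Rightarrow> 'b) \<Rightarrow> bool" where
  "approx_unitarily_equiv X Y \<longleftrightarrow>
     (\<exists>V :: nat \<Rightarrow> 'b \<Rightarrow> 'a. (\<forall>k. unitary_op (V k)) \<and>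
        (\<lambda>k. onorm (\<lambda>x. (cadjoint (V k) \<circ> X \<circ> V k) x - Y x)) \<longlonglongrightarrow> 0)"

lemma cadjoint_eqI:
  assumes "\<And>x y. cinner (T x) y = cinner x (S y)"
  shows "cadjoint T = S"
  unfolding cadjoint_def
proof (rule the_equality)
  show "\<forall>x y. cinner (T x) y = cinner x (S y)" using assms by blast
next
  fix S' assume "\<forall>x y. cinner (T x) y = cinner x (S' y)"
  then show "S' = S" by (intro ext cinner_eq_all_imp_eq) (metis assms)
qed

lemma unitary_op_inj:
  assumes "unitary_op V"
  shows "inj V"
proof (rule injI)
  fix x y assume "V x = V y"
  then show "x = y"
    using assms unfolding unitary_op_def by (metis cinner_eq_all_imp_eq)
qed

lemma cadjoint_unitary:
  assumes "unitary_op V"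
  shows "cadjoint V = inv V"
proof (rule cadjoint_eqI)
  fix x y
  have "V (inv V y) = y" using assms by (simp add: unitary_op_def surj_f_inv_f)
  then show "cinner (V x) y = cinner x (inv V y)"
    using assms unfolding unitary_op_def by metis
qed

lemma cadjoint_unitary_comp:
  assumes "unitary_op V"
  shows "cadjoint V \<circ> V = id" "V \<circ> cadjoint V = id"
  using assms unitary_op_inj[OF assms]
  by (simp_all add: cadjoint_unitary unitary_op_def surj_iff)


section \<open>The operator matrix \<open>J\<^sub>n(T)\<close>\<close>

text \<open>
  The integer \<open>n\<close> is \<open>CARD('n)\<close>, and the elements of the finite linearly ordered index type \<open>'n\<close>
  are numbered \<open>1, \<dots>, n\<close> in increasing order by \<open>index_pos\<close>. Every \<open>n \<ge> 1\<close> is the cardinality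
  of such a type, e.g. of a numeral type.
\<close>

definition index_pos :: "'n::{finite,linorder} \<Rightarrow> nat" where
  "index_pos i = card {..i}"

definition J_entry ::
    "('a::complex_inner \<Rightarrow> 'a) \<Rightarrow> 'n::{finite,linorder} \<Rightarrow> 'n \<Rightarrow> 'a \<Rightarrow> 'a" where
  "J_entry T i j =
     (if index_pos j = index_pos i + 1 then (\<lambda>x. x)
      else if index_pos i = CARD('n) \<and> index_pos j = 1 then T
      else (\<lambda>x. 0))"

definition J_op ::
    "('a::complex_inner \<Rightarrow> 'a) \<Rightarrow> 'a ^ ('n::{finite,linorder}) \<Rightarrow> 'a ^ ('n::{finite,linorder})" where
  "J_op T x = (\<chi> i. \<Sum>j\<in>UNIV. J_entry T i j (x $ j))"

lemma bij_betw_index_pos: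
  "bij_betw index_pos (UNIV :: 'n::{finite,linorder} set) {1..CARD('n)}"
proof -
  have lt: "index_pos i < index_pos j" if "i < j" for i j :: 'n
    unfolding index_pos_def using that by (intro psubset_card_mono) auto
  then have inj: "inj (index_pos :: 'n \<Rightarrow> nat)"
    by (metis injI less_irrefl linorder_neqE)
  have "index_pos i \<in> {1..CARD('n)}" for i :: 'n
  proof -
    have "card {..i} > 0" by (subst card_gt_0_iff) auto
    moreover have "card {..i} \<le> CARD('n)" by (rule card_mono) auto
    ultimately show ?thesis by (simp add: index_pos_def)
  qed
  then have "range (index_pos :: 'n \<Rightarrow> nat) \<subseteq> {1..CARD('n)}" by blast
  moreover have "card (range (index_pos :: 'n \<Rightarrow> nat)) = card {1..CARD('n)}"
    using inj by (simp add: card_image)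
  ultimately have "range (index_pos :: 'n \<Rightarrow> nat) = {1..CARD('n)}"
    by (intro card_subset_eq) auto
  with inj show ?thesis by (simp add: bij_betw_def)
qed

lemma bounded_clinear_imp_bounded_linear:
  assumes "bounded_clinear T"
  shows "bounded_linear T"
proof -
  from assms obtain K where lin: "Vector_Spaces.linear scaleC scaleC T"
    and K: "\<And>x. norm (T x) \<le> norm x * K"
    unfolding bounded_clinear_def by blast
  interpret Vector_Spaces.linear scaleC scaleC T by (fact lin)
  show ?thesis
    by (rule bounded_linear_intro[where K = K]) (simp_all add: add scale scaleR_scaleC K)
qed

lemma bounded_clinear_iff:
  "bounded_clinear T \<longleftrightarrow> bounded_linear T \<and> (\<forall>a x. T (a *\<^sub>C x) = a *\<^sub>C T x)"
proof
  assume T: "bounded_clinear T"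
  then interpret Vector_Spaces.linear scaleC scaleC T by (simp add: bounded_clinear_def)
  show "bounded_linear T \<and> (\<forall>a x. T (a *\<^sub>C x) = a *\<^sub>C T x)"
    using T by (simp add: bounded_clinear_imp_bounded_linear scale)
next
  assume T: "bounded_linear T \<and> (\<forall>a x. T (a *\<^sub>C x) = a *\<^sub>C T x)"
  then interpret bounded_linear T by simp
  have "Vector_Spaces.linear scaleC scaleC T"
    by unfold_locales (use T in \<open>simp_all add: add\<close>)
  with bounded show "bounded_clinear T"
    unfolding bounded_clinear_def by blast
qed

lemma bounded_clinear_J_op:
  assumes "bounded_clinear T"
  shows "bounded_clinear (J_op T :: 'a::complex_inner ^ ('n::{finite,linorder}) \<Rightarrow> 'a ^ ('n::{finite,linorder}))"
proof -
  have T: "bounded_linear T" and TC: "\<And>a x. T (a *\<^sub>C x) = a *\<^sub>C T x"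
    using assms by (auto simp: bounded_clinear_iff)
  have entry: "bounded_linear (J_entry T i j)" for i j :: 'n
    using T by (auto simp: J_entry_def bounded_linear_ident)
  have entryC: "J_entry T i j (a *\<^sub>C x) = a *\<^sub>C J_entry T i j x" for i j :: 'n and a x
    by (simp add: J_entry_def TC)
  have row: "bounded_linear (\<lambda>x :: ('a, 'n) vec. \<Sum>j\<in>UNIV. J_entry T i j (x $ j))" for i :: 'n
    by (intro bounded_linear_sum bounded_linear_compose[OF entry] bounded_linear_vec_nth)
  have "bounded_linear (J_op T :: ('a, 'n) vec \<Rightarrow> ('a, 'n) vec)"
  proof -
    from row have "\<exists>K. \<forall>x. norm (\<Sum>j\<in>UNIV. J_entry T i j (x $ j)) \<le> norm x * K" for i :: 'n
      by (rule bounded_linear.bounded)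
    then obtain K where
      K: "\<And>i (x :: ('a, 'n) vec). norm (\<Sum>j\<in>UNIV. J_entry T i j (x $ j)) \<le> norm x * K i"
      by metis
    show ?thesis
    proof (rule bounded_linear_intro[where K = "\<Sum>i\<in>UNIV. K i"])
      fix x y :: "('a, 'n) vec" and r :: real
      show "J_op T (x + y) = J_op T x + J_op T y"
        using linear_add[OF bounded_linear.linear[OF row], of _ x y]
        by (simp add: J_op_def vec_eq_iff)
      show "J_op T (r *\<^sub>R x) = r *\<^sub>R J_op T x"
        using linear_scale[OF bounded_linear.linear[OF row], of _ r x]
        by (simp add: J_op_def vec_eq_iff)
      have "norm (J_op T x) \<le> (\<Sum>i\<in>UNIV. norm (J_op T x $ i))"
        unfolding norm_vec_def by (rule L2_set_le_sum) simp
      also have "\<dots> \<le> (\<Sum>i\<in>UNIV. norm x * K i)"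
        by (intro sum_mono) (simp add: J_op_def K)
      finally show "norm (J_op T x) \<le> norm x * (\<Sum>i\<in>UNIV. K i)"
        by (simp add: sum_distrib_left)
    qed
  qed
  moreover have "J_op T (a *\<^sub>C x) = a *\<^sub>C J_op T x" for a and x :: "('a, 'n) vec"
    by (simp add: J_op_def scaleC_vec_def vec_eq_iff entryC complex_vector.scale_sum_right)
  ultimately show ?thesis by (simp add: bounded_clinear_iff)
qed

end

theory Submission
  imports Defs
begin

text \<open>
  Write \<open>J = J\<^sub>n(T)\<close>. Solving \<open>(J - \<mu>) v = w\<close> coordinatewise shows that \<open>J - \<mu>\<close> is invertible iff
  \<open>T - \<mu>\<^sup>n\<close> is. By stability \<open>T - \<mu>\<close> is then invertible iff \<open>T - \<mu>\<^sup>n\<close> is, and the vectors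
  \<open>(y, \<mu> y, \<dots>, \<mu>\<^sup>n\<^sup>-\<^sup>1 y)\<close> give a quantitative form: if \<open>c(\<mu>)\<close> is the norm of \<open>(T - \<mu>)\<^sup>-\<^sup>1\<close>, then
  \<open>c(\<mu>\<^sup>n) \<le> c(\<mu>)\<close>, and even \<open>c(\<mu>\<^sup>n) \<le> c(\<mu>) / sqrt n\<close> when \<open>\<bar>\<mu>\<bar> = 1\<close>. Iterating \<open>\<mu> \<mapsto> \<mu>\<^sup>n\<close>:
  for \<open>\<bar>\<mu>\<bar> = 1\<close> the resolvent norms would tend to \<open>0\<close>, contradicting \<open>c(\<mu>) \<ge> 1 / (\<parallel>T\<parallel> + 1)\<close>, so the
  unit circle lies in the spectrum; for \<open>\<bar>\<mu>\<bar> < 1\<close> they stay bounded while the points tend to \<open>0\<close>,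
  so one point of the open disc in the resolvent set forces \<open>T\<close> to be invertible; conversely,
  openness of the resolvent set at \<open>0\<close> and at infinity propagates to the whole open disc (if \<open>T\<close>
  is invertible) and to the exterior of the closed disc.
\<close>

section \<open>Invertibility with a bound on the inverse\<close>

text \<open>For linear \<open>A\<close> this means bijectivity with an inverse of norm at most
  \<open>c\<close>. Keeping \<open>c\<close> explicit allows resolvent norms at different points to
  be compared.\<close>

definition invertible_bound :: "real \<Rightarrow> ('a::real_normed_vector \<Rightarrow> 'b::real_normed_vector) \<Rightarrow> bool" where
  "invertible_bound c A \<longleftrightarrow> c > 0 \<and> surj A \<and> (\<forall>x. norm x \<le> c * norm (A x))"

lemma norm_scaleC: "norm (a *\<^sub>C x) = cmod a * norm x"
  for x :: "'a::complex_inner"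
proof -
  have "cinner (a *\<^sub>C x) (a *\<^sub>C x) = (a * cnj a) * cinner x x"
    by (simp add: cinner_scaleC_left cinner_scaleC_right)
  also have "a * cnj a = complex_of_real ((cmod a)\<^sup>2)"
    unfolding complex_norm_square ..
  finally have "inner (a *\<^sub>C x) (a *\<^sub>C x) = (cmod a)\<^sup>2 * inner x x"
    by (simp add: inner_eq_Re_cinner)
  then show ?thesis
    by (simp add: norm_eq_sqrt_inner real_sqrt_mult)
qed

lemma bounded_clinear_scaleC: "bounded_clinear ((*\<^sub>C) a)"
proof -
  have "Vector_Spaces.linear (*\<^sub>C) (*\<^sub>C) ((*\<^sub>C) a :: 'a \<Rightarrow> 'a)"
    by unfold_locales (simp_all add: scaleC_add_right scaleC_scaleC mult.commute)
  moreover have "\<forall>x :: 'a. norm (a *\<^sub>C x) \<le> norm x * cmod a"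
    by (simp add: norm_scaleC mult.commute)
  ultimately show ?thesis
    unfolding bounded_clinear_def by blast
qed

lemma bounded_clinear_shift:
  fixes T :: "'a::complex_inner \<Rightarrow> 'a"
  assumes "bounded_clinear T"
  shows "bounded_clinear (\<lambda>x. T x - z *\<^sub>C x)"
  using assms bounded_clinear_scaleC[of z, where 'a = 'a] unfolding bounded_clinear_iff
  by (auto intro!: bounded_linear_sub
      simp: complex_vector.scale_right_diff_distrib scaleC_scaleC mult.commute)

text \<open>The lower bound yields injectivity, and at \<open>inv A y\<close> it becomes the norm
  bound for the inverse; linearity of \<open>inv A\<close> follows from uniqueness of
  preimages.\<close>

lemma invertible_op_iff_bound:
  assumes A: "bounded_clinear A"
  shows "invertible_op A \<longleftrightarrow> (\<exists>c. invertible_bound c A)"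
proof
  assume "invertible_op A"
  then obtain S where S: "bounded_clinear S" "S \<circ> A = id" "A \<circ> S = id"
    unfolding invertible_op_def by blast
  obtain K where K: "K > 0" "\<And>x. norm (S x) \<le> norm x * K"
    using bounded_linear.pos_bounded[OF bounded_clinear_imp_bounded_linear[OF S(1)]] by blast
  have "norm x \<le> K * norm (A x)" for x
    using K(2)[of "A x"] fun_cong[OF S(2), of x] by (simp add: mult.commute)
  moreover have "surj A"
    using S(3) by (metis comp_apply id_apply surj_def)
  ultimately show "\<exists>c. invertible_bound c A"
    using K(1) unfolding invertible_bound_def by blast
next
  assume "\<exists>c. invertible_bound c A"
  then obtain c where c: "c > 0" "surj A" "\<And>x. norm x \<le> c * norm (A x)"
    unfolding invertible_bound_def by blast
  from A have lin: "bounded_linear A" and sc: "\<And>a x. A (a *\<^sub>C x) = a *\<^sub>C A x"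
    by (auto simp: bounded_clinear_iff)
  interpret bounded_linear A by (fact lin)
  have inj: "inj A"
  proof (rule injI)
    fix x y assume "A x = A y"
    then show "x = y" using c(3)[of "x - y"] by (simp add: diff)
  qed
  have AS: "A (inv A y) = y" for y
    using c(2) by (simp add: surj_f_inv_f)
  have S_eqI: "inv A y = x" if "A x = y" for x y
    using that inj by (metis inv_f_f)
  have "bounded_linear (inv A)"
  proof (rule bounded_linear_intro[where K = c])
    show "inv A (x + y) = inv A x + inv A y" for x y by (rule S_eqI) (simp add: add AS)
    show "inv A (r *\<^sub>R x) = r *\<^sub>R inv A x" for r x by (rule S_eqI) (simp add: scaleR AS)
    show "norm (inv A x) \<le> norm x * c" for x
      using c(3)[of "inv A x"] by (simp add: AS mult.commute)
  qed
  moreover have "inv A (a *\<^sub>C x) = a *\<^sub>C inv A x" for a x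
    by (rule S_eqI) (simp add: sc AS)
  ultimately have "bounded_clinear (inv A)"
    by (simp add: bounded_clinear_iff)
  moreover have "inv A \<circ> A = id" "A \<circ> inv A = id"
    using inj AS by auto
  ultimately show "invertible_op A"
    unfolding invertible_op_def by blast
qed

text \<open>Solving \<open>B x = y\<close> means finding a fixed point of
  \<open>inv A (y + (A x - B x))\<close>, a contraction with constant \<open>c * e\<close>. For the
  bound, the error term \<open>c * e * norm x\<close> is absorbed into the left-hand side.\<close>

lemma invertible_bound_perturb:
  fixes A B :: "'a::{real_normed_vector, complete_space} \<Rightarrow> 'b::real_normed_vector"
  assumes "invertible_bound c A" "linear A" "linear B"
    and close: "\<And>x. norm (A x - B x) \<le> e * norm x" and e: "0 \<le> e" "c * e < 1"
  shows "invertible_bound (c / (1 - c * e)) B"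
proof -
  from assms(1) have c: "c > 0" "surj A" "\<And>x. norm x \<le> c * norm (A x)"
    unfolding invertible_bound_def by blast+
  note dA = linear_diff[OF assms(2)] and dB = linear_diff[OF assms(3)]
  have AS: "A (inv A y) = y" for y
    using c(2) by (simp add: surj_f_inv_f)
  have "\<exists>x. B x = y" for y
  proof -
    define f where "f x = inv A (y + (A x - B x))" for x
    have "dist (f x) (f x') \<le> c * e * dist x x'" for x x'
    proof -
      have "norm (f x - f x') \<le> c * norm (A (f x - f x'))" by (rule c(3))
      also have "A (f x - f x') = A (x - x') - B (x - x')"
        by (simp add: dA dB f_def AS)
      also have "c * norm \<dots> \<le> c * (e * norm (x - x'))"
        using c(1) close by (intro mult_left_mono) auto
      finally show ?thesis by (simp add: dist_norm)
    qed
    then have "\<exists>!x. x \<in> UNIV \<and> f x = x"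
      using c(1) e by (intro Banach_fix[where c = "c * e"]) (auto simp: complete_UNIV)
    then obtain x where "f x = x" by blast
    then have "A x = y + (A x - B x)" by (metis AS f_def)
    then have "B x = y" by (simp add: algebra_simps)
    then show ?thesis ..
  qed
  then have "surj B" by (metis surj_def)
  moreover have "norm x \<le> c / (1 - c * e) * norm (B x)" for x
  proof -
    have "norm x \<le> c * norm (A x)" by (rule c(3))
    also have "norm (A x) \<le> norm (B x) + norm (A x - B x)"
      by (metis add.commute diff_add_cancel norm_triangle_ineq)
    also have "\<dots> \<le> norm (B x) + e * norm x"
      using close by simp
    finally have "norm x * (1 - c * e) \<le> c * norm (B x)"
      using c(1) by (simp add: algebra_simps)
    then show ?thesis
      using e by (simp add: pos_le_divide_eq)
  qed
  ultimately show ?thesis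
    using c(1) e unfolding invertible_bound_def by simp
qed


section \<open>Approximate unitary equivalence\<close>

text \<open>Approximate equivalence reduced to what transporting \<open>invertible_bound\<close>
  requires: real-linear surjective isometries, no adjoints and no complex structure.\<close>

definition almost_intertwined ::
    "('a::real_normed_vector \<Rightarrow> 'a) \<Rightarrow> ('b::real_normed_vector \<Rightarrow> 'b) \<Rightarrow> bool" where
  "almost_intertwined A B \<longleftrightarrow>
     (\<forall>e>0. \<exists>U :: 'b \<Rightarrow> 'a. linear U \<and> surj U \<and> (\<forall>x. norm (U x) = norm x) \<and>
        (\<forall>x. norm (A (U x) - U (B x)) \<le> e * norm x))"

lemma linear_isometry_inv:
  assumes "linear U" "surj U" "\<And>x. norm (U x) = norm x"
  shows "linear (inv U)" "surj (inv U)" "norm (inv U y) = norm y" "inv U (U x) = x"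
proof -
  have "inj U"
    using assms(3) linear_injective_0[OF assms(1)] by (metis norm_eq_zero)
  then have eq: "inv U (U x) = x" for x by simp
  then show "inv U (U x) = x" .
  show "surj (inv U)" by (metis eq surj_def)
  have UV: "U (inv U y) = y" for y
    using assms(2) by (simp add: surj_f_inv_f)
  then show "norm (inv U y) = norm y" by (metis assms(3))
  show "linear (inv U)"
  proof (rule linearI)
    fix x y r
    have "U (inv U x + inv U y) = x + y" "U (r *\<^sub>R inv U x) = r *\<^sub>R x"
      by (simp_all add: UV linear_add[OF assms(1)] linear_scale[OF assms(1)])
    then show "inv U (x + y) = inv U x + inv U y" "inv U (r *\<^sub>R x) = r *\<^sub>R inv U x"
      by (metis eq)+
  qed
qed

lemma almost_intertwined_sym:
  assumes "almost_intertwined A B"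
  shows "almost_intertwined B A"
  unfolding almost_intertwined_def
proof (intro allI impI)
  fix e :: real assume "e > 0"
  then obtain U where U: "linear U" "surj U" "\<And>x. norm (U x) = norm x"
    and close: "\<And>x. norm (A (U x) - U (B x)) \<le> e * norm x"
    using assms unfolding almost_intertwined_def by blast
  note V = linear_isometry_inv[OF U]
  have "norm (B (inv U x) - inv U (A x)) \<le> e * norm x" for x
  proof -
    have "norm (B (inv U x) - inv U (A x)) = norm (U (B (inv U x) - inv U (A x)))"
      by (simp add: U(3))
    also have "U (B (inv U x) - inv U (A x)) = - (A (U (inv U x)) - U (B (inv U x)))"
      using U(2) by (simp add: linear_diff[OF U(1)] surj_f_inv_f)
    finally show ?thesis
      using close[of "inv U x"] by (simp only: norm_minus_cancel V(3))
  qed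
  then show "\<exists>V. linear V \<and> surj V \<and> (\<forall>x. norm (V x) = norm x) \<and>
      (\<forall>x. norm (B (V x) - V (A x)) \<le> e * norm x)"
    using V by blast
qed

text \<open>The lower bound survives the limit \<open>e\<close> to 0 with the same constant, so
  iterating the transfer costs nothing. Surjectivity needs only one sufficiently good
  isometry.\<close>

lemma invertible_bound_intertwined:
  fixes A :: "'a::{real_normed_vector, complete_space} \<Rightarrow> 'a" and B :: "'b::real_normed_vector \<Rightarrow> 'b"
  assumes AB: "almost_intertwined A B" and A: "linear A" and B: "linear B"
    and c: "invertible_bound c A"
  shows "invertible_bound c B"
proof -
  from c have "c > 0" and low: "\<And>x. norm x \<le> c * norm (A x)"
    unfolding invertible_bound_def by blast+
  have "surj B"
  proof -
    \<comment> \<open>With this error the perturbation product \<open>c * e\<close> equals 1/2, so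
      \<open>U \<circ> B \<circ> inv U\<close> is still surjective.\<close>
    have "1 / (2 * c) > 0" using \<open>c > 0\<close> by simp
    then obtain U where U: "linear U" "surj U" "\<And>x. norm (U x) = norm x"
      and close: "\<And>x. norm (A (U x) - U (B x)) \<le> 1 / (2 * c) * norm x"
      using AB unfolding almost_intertwined_def by blast
    note V = linear_isometry_inv[OF U]
    have "norm (A x - (U \<circ> B \<circ> inv U) x) \<le> 1 / (2 * c) * norm x" for x
      using close[of "inv U x"] U(2) by (simp add: V(3) surj_f_inv_f)
    then have "invertible_bound (c / (1 - c * (1 / (2 * c)))) (U \<circ> B \<circ> inv U)"
      using \<open>c > 0\<close> U(1) A B V(1)
      by (intro invertible_bound_perturb[OF c]) (auto intro!: linear_compose)
    then have surj: "surj (\<lambda>x. U (B (inv U x)))"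
      by (simp add: invertible_bound_def comp_def)
    show ?thesis
      unfolding surj_def
    proof (rule allI)
      fix y
      obtain x where "U y = U (B (inv U x))"
        using surjD[OF surj, of "U y"] by blast
      then have "inv U (U y) = inv U (U (B (inv U x)))" by (rule arg_cong)
      then show "\<exists>x. y = B x" by (auto simp: V(4))
    qed
  qed
  moreover have "norm x \<le> c * norm (B x)" for x
  proof (rule field_le_epsilon)
    fix d :: real assume "d > 0"
    \<comment> \<open>Chosen so that the total error \<open>c * (e * (norm x + 1))\<close> is
      exactly \<open>d\<close>; the summand 1 keeps the denominator nonzero at
      \<open>x = 0\<close>.\<close>
    define e where "e = d / (c * (norm x + 1))"
    have "e > 0" using \<open>d > 0\<close> \<open>c > 0\<close> by (simp add: e_def add_nonneg_pos)
    then obtain U where U: "\<And>x. norm (U x) = norm x"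
      and close: "\<And>x. norm (A (U x) - U (B x)) \<le> e * norm x"
      using AB unfolding almost_intertwined_def by blast
    have "norm x \<le> c * norm (A (U x))"
      using low[of "U x"] by (simp add: U)
    also have "norm (A (U x)) \<le> norm (U (B x)) + norm (A (U x) - U (B x))"
      by (metis add.commute diff_add_cancel norm_triangle_ineq)
    also have "\<dots> \<le> norm (B x) + e * (norm x + 1)"
      using close[of x] \<open>e > 0\<close> by (simp add: U algebra_simps)
    finally have "norm x \<le> c * norm (B x) + c * (e * (norm x + 1))"
      using \<open>c > 0\<close> by (simp add: algebra_simps)
    moreover have "norm x + 1 \<noteq> 0"
      by (metis add_nonneg_pos less_irrefl norm_ge_zero zero_less_one)
    then have "c * (e * (norm x + 1)) = d"
      using \<open>c > 0\<close> by (simp add: e_def)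
    ultimately show "norm x \<le> c * norm (B x) + d" by simp
  qed
  ultimately show ?thesis
    using \<open>c > 0\<close> unfolding invertible_bound_def by blast
qed

text \<open>The adjoint of a unitary is its inverse, so applying \<open>U\<close> turns
  \<open>inv U (X (U x)) - Y x\<close> into the intertwining error without changing its norm. The
  shifts by \<open>z\<close> cancel because \<open>U\<close> is complex linear.\<close>

lemma approx_unitarily_equiv_imp_almost_intertwined:
  assumes XY: "approx_unitarily_equiv X Y" and X: "bounded_clinear X" and Y: "bounded_clinear Y"
  shows "almost_intertwined (\<lambda>x. X x - z *\<^sub>C x) (\<lambda>x. Y x - z *\<^sub>C x)"
  unfolding almost_intertwined_def
proof (intro allI impI)
  fix e :: real assume "e > 0"
  obtain V where V: "\<And>k. unitary_op (V k)"
    and lim: "(\<lambda>k. onorm (\<lambda>x. (cadjoint (V k) \<circ> X \<circ> V k) x - Y x)) \<longlonglongrightarrow> 0"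
    using XY unfolding approx_unitarily_equiv_def by blast
  have "\<forall>\<^sub>F k in sequentially. onorm (\<lambda>x. (cadjoint (V k) \<circ> X \<circ> V k) x - Y x) < e"
    using order_tendstoD(2)[OF lim \<open>e > 0\<close>] .
  then obtain k where k: "onorm (\<lambda>x. (cadjoint (V k) \<circ> X \<circ> V k) x - Y x) < e"
    unfolding eventually_sequentially by blast
  define U where "U = V k"
  have "bounded_clinear U" and surj: "surj U" and iso: "cinner (U x) (U y) = cinner x y" for x y
    using V[of k] by (auto simp: U_def unitary_op_def)
  then have bU: "bounded_linear U" and UC: "\<And>a x. U (a *\<^sub>C x) = a *\<^sub>C U x"
    by (auto simp: bounded_clinear_iff)
  have norm: "norm (U x) = norm x" for x
    by (simp add: norm_eq_sqrt_inner inner_eq_Re_cinner iso)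
  have adj: "cadjoint U = inv U"
    using V[of k] by (simp add: U_def cadjoint_unitary)
  note linU = bounded_linear.linear[OF bU]
  note W = linear_isometry_inv[OF linU surj norm]
  have bW: "bounded_linear (inv U)"
    using W(1,3) by (intro bounded_linear.intro bounded_linear_axioms.intro) (auto intro: exI[of _ 1])
  have bnd: "bounded_linear (\<lambda>x. inv U (X (U x)) - Y x)"
    using bU bW bounded_clinear_imp_bounded_linear[OF X] bounded_clinear_imp_bounded_linear[OF Y]
    by (intro bounded_linear_sub) (auto intro: bounded_linear_compose)
  have "norm ((X (U x) - z *\<^sub>C U x) - U (Y x - z *\<^sub>C x)) \<le> e * norm x" for x
  proof -
    have "(X (U x) - z *\<^sub>C U x) - U (Y x - z *\<^sub>C x) = U (inv U (X (U x)) - Y x)"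
      using surj by (simp add: linear_diff[OF linU] UC surj_f_inv_f)
    also have "norm \<dots> = norm (inv U (X (U x)) - Y x)" by (rule norm)
    also have "\<dots> \<le> onorm (\<lambda>x. inv U (X (U x)) - Y x) * norm x"
      by (rule onorm[OF bnd])
    also have "\<dots> \<le> e * norm x"
      using k by (intro mult_right_mono) (auto simp: U_def[symmetric] adj comp_def)
    finally show ?thesis .
  qed
  then show "\<exists>U. linear U \<and> surj U \<and> (\<forall>x. norm (U x) = norm x) \<and>
      (\<forall>x. norm ((X (U x) - z *\<^sub>C U x) - U (Y x - z *\<^sub>C x)) \<le> e * norm x)"
    using linU surj norm by blast
qed


section \<open>The resolvent of \<open>J\<^sub>n(T)\<close>\<close>

definition index_at :: "nat \<Rightarrow> 'n::{finite,linorder}" where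
  "index_at = inv_into UNIV index_pos"

lemma index_pos_index_at:
  assumes "1 \<le> k" "k \<le> CARD('n)"
  shows "index_pos (index_at k :: 'n::{finite,linorder}) = k"
  using bij_betw_inv_into_right[OF bij_betw_index_pos[where 'n = 'n], of k] assms
  by (simp add: index_at_def)

lemma index_at_index_pos: "index_at (index_pos i) = i"
  using bij_betw_inv_into_left[OF bij_betw_index_pos, of i] by (simp add: index_at_def)

lemma index_pos_bounds: "1 \<le> index_pos i" "index_pos i \<le> CARD('n)"
  for i :: "'n::{finite,linorder}"
  using bij_betwE[OF bij_betw_index_pos, rule_format, of i] by auto

lemma index_pos_eq_iff:
  assumes "1 \<le> k" "k \<le> CARD('n)"
  shows "index_pos i = k \<longleftrightarrow> i = (index_at k :: 'n::{finite,linorder})"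
  using index_pos_index_at[OF assms] index_at_index_pos[of i] by metis

section \<open>Rows of \<open>J_op T\<close> in numbered coordinates\<close>

lemma vec_eq_index_atI:
  fixes x y :: "'a ^ ('n::{finite,linorder})"
  assumes "\<And>k. 1 \<le> k \<Longrightarrow> k \<le> CARD('n) \<Longrightarrow> x $ index_at k = y $ index_at k"
  shows "x = y"
  unfolding vec_eq_iff by (metis assms index_at_index_pos index_pos_bounds)

lemma J_op_nth_less:
  fixes x :: "'a::complex_inner ^ ('n::{finite,linorder})"
  assumes "1 \<le> k" "k < CARD('n)"
  shows "J_op T x $ index_at k = x $ index_at (Suc k)"
proof -
  have "J_op T x $ index_at k = (\<Sum>j\<in>UNIV. if j = index_at (Suc k) then x $ j else 0)"
    unfolding J_op_def vec_lambda_beta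
    using assms by (intro sum.cong) (auto simp: J_entry_def index_pos_index_at index_pos_eq_iff)
  then show ?thesis by simp
qed

lemma J_op_nth_last:
  fixes x :: "'a::complex_inner ^ ('n::{finite,linorder})"
  shows "J_op T x $ index_at CARD('n) = T (x $ index_at 1)"
proof -
  \<comment> \<open>The identity branch of \<open>J_entry\<close> is tested first, so it must be
    ruled out in the last row.\<close>
  have *: "index_pos j \<noteq> Suc CARD('n)" for j :: 'n
    using index_pos_bounds(2)[of j] by linarith
  have "J_op T x $ index_at CARD('n) = (\<Sum>j\<in>UNIV. if j = index_at 1 then T (x $ j) else 0)"
    unfolding J_op_def vec_lambda_beta
    using index_pos_eq_iff[of 1, where 'n = 'n] *
    by (intro sum.cong) (auto simp: J_entry_def index_pos_index_at Suc_leI)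
  then show ?thesis by simp
qed

text \<open>The vector (y, z y, ..., z^(n-1) y), on which the shift rows of \<open>J_op T\<close>
  act as multiplication by \<open>z\<close>. Positions start at 1, hence the subtraction in the
  exponent.\<close>

definition geometric_vec :: "complex \<Rightarrow> 'a::complex_inner \<Rightarrow> 'a ^ ('n::{finite,linorder})" where
  "geometric_vec z y = (\<chi> i. z ^ (index_pos i - 1) *\<^sub>C y)"

lemma geometric_vec_nth:
  assumes "1 \<le> k" "k \<le> CARD('n)"
  shows "(geometric_vec z y :: 'a::complex_inner ^ ('n::{finite,linorder})) $ index_at k = z ^ (k - 1) *\<^sub>C y"
  using assms by (simp add: geometric_vec_def index_pos_index_at)

lemma J_op_geometric_vec:
  fixes T :: "'a::complex_inner \<Rightarrow> 'a"
  shows "J_op T (geometric_vec z y) - z *\<^sub>C geometric_vec z y =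
    (axis (index_at CARD('n)) (T y - z ^ CARD('n) *\<^sub>C y) :: 'a ^ ('n::{finite,linorder}))"
proof (rule vec_eq_index_atI)
  let ?g = "geometric_vec z y :: ('a, 'n) vec"
  fix k assume k: "1 \<le> k" "k \<le> CARD('n)"
  have pw: "z * z ^ (k - 1) = z ^ k"
    using k(1) by (metis One_nat_def Suc_le_lessD power_minus_mult mult.commute)
  show "(J_op T ?g - z *\<^sub>C ?g) $ index_at k =
     (axis (index_at CARD('n)) (T y - z ^ CARD('n) *\<^sub>C y) :: ('a, 'n) vec) $ index_at k"
  proof (cases "k = CARD('n)")
    case True
    have "?g $ index_at 1 = y"
      using k geometric_vec_nth[of 1, where 'n = 'n] by (simp add: scaleC_one)
    moreover have "z *\<^sub>C ?g $ index_at k = z ^ k *\<^sub>C y"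
      by (simp only: geometric_vec_nth[OF k] scaleC_scaleC pw)
    ultimately show ?thesis
      using True J_op_nth_last[of T ?g]
      by (simp add: scaleC_vec_def)
  next
    case False
    then have "index_at k \<noteq> (index_at CARD('n) :: 'n)"
      using k index_pos_index_at[of k, where 'n = 'n] index_pos_index_at[of "CARD('n)", where 'n = 'n] by auto
    with False k pw show ?thesis
      by (simp add: J_op_nth_less geometric_vec_nth scaleC_vec_def scaleC_scaleC axis_def)
  qed
qed

text \<open>All rows but the last have right-hand side 0 and force \<open>v\<close> to be geometric;
  the last row is then the equation for T - z^n at the first coordinate.\<close>

lemma J_op_shift_solve:
  fixes v :: "'a::complex_inner ^ ('n::{finite,linorder})"
  assumes "J_op T v - z *\<^sub>C v = axis (index_at CARD('n)) x"
  shows "T (v $ index_at 1) - z ^ CARD('n) *\<^sub>C (v $ index_at 1) = x"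
proof -
  let ?n = "CARD('n)"
  have n: "1 \<le> ?n" by (simp add: Suc_leI)
  have eq: "J_op T v $ i - z *\<^sub>C (v $ i) = axis (index_at ?n) x $ i" for i
    using arg_cong[OF assms, of "\<lambda>w. w $ i"] by (simp add: scaleC_vec_def)
  have geo: "Suc k \<le> ?n \<Longrightarrow> v $ index_at (Suc k) = z ^ k *\<^sub>C (v $ index_at 1)" for k
  proof (induction k)
    case 0
    then show ?case by (simp add: scaleC_one)
  next
    case (Suc k)
    then have "index_at (Suc k) \<noteq> (index_at ?n :: 'n)"
      using index_pos_index_at[of "Suc k", where 'n = 'n] index_pos_index_at[of ?n, where 'n = 'n] by auto
    then have "v $ index_at (Suc (Suc k)) = z *\<^sub>C (v $ index_at (Suc k))"
      using eq[of "index_at (Suc k)"] Suc.prems by (simp add: J_op_nth_less axis_def)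
    with Suc show ?case by (simp add: scaleC_scaleC)
  qed
  have "v $ index_at ?n = z ^ (?n - 1) *\<^sub>C (v $ index_at 1)"
    using geo[of "?n - 1"] n by simp
  moreover have "z * z ^ (?n - 1) = z ^ ?n"
    using n by (metis One_nat_def Suc_le_lessD power_minus_mult mult.commute)
  ultimately show ?thesis
    using eq[of "index_at ?n"] n by (simp add: J_op_nth_last scaleC_scaleC)
qed

section \<open>From invertibility of J - z to that of T - z^n\<close>

lemma surj_of_J_op_shift:
  fixes T :: "'a::complex_inner \<Rightarrow> 'a"
  assumes "surj (\<lambda>v :: 'a ^ ('n::{finite,linorder}). J_op T v - z *\<^sub>C v)"
  shows "surj (\<lambda>x. T x - z ^ CARD('n) *\<^sub>C x)"
  unfolding surj_def
proof (rule allI)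
  fix x :: 'a
  obtain v :: "('a, 'n) vec" where "J_op T v - z *\<^sub>C v = axis (index_at CARD('n)) x"
    using surjD[OF assms, of "axis (index_at CARD('n)) x"] by metis
  from J_op_shift_solve[OF this] show "\<exists>y. x = T y - z ^ CARD('n) *\<^sub>C y"
    by (intro exI[of _ "v $ index_at 1"]) simp
qed

lemma norm_axis: "norm (axis i x) = norm x"
  for x :: "'a::real_inner"
  by (simp add: norm_eq_sqrt_inner inner_axis_axis)

text \<open>The lower bound for J - z is tested on a geometric vector, whose image has a single
  nonzero coordinate at most. The norm on the left is estimated later in two ways, for general and
  for unimodular \<open>z\<close>.\<close>

lemma norm_geometric_vec_bound:
  fixes T :: "'a::complex_inner \<Rightarrow> 'a"
  assumes "invertible_bound c (\<lambda>v :: 'a ^ ('n::{finite,linorder}). J_op T v - z *\<^sub>C v)"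
  shows "norm (geometric_vec z y :: ('a, 'n) vec) \<le> c * norm (T y - z ^ CARD('n) *\<^sub>C y)"
proof -
  let ?g = "geometric_vec z y :: ('a, 'n) vec"
  have "norm ?g \<le> c * norm (J_op T ?g - z *\<^sub>C ?g)"
    using assms by (simp add: invertible_bound_def)
  then show ?thesis by (simp only: J_op_geometric_vec norm_axis)
qed

lemma norm_geometric_vec_ge: "norm y \<le> norm (geometric_vec z y :: 'a::complex_inner ^ ('n::{finite,linorder}))"
proof -
  have "(geometric_vec z y :: ('a, 'n) vec) $ index_at 1 = y"
    by (simp add: geometric_vec_nth scaleC_one Suc_leI)
  then show ?thesis by (metis Finite_Cartesian_Product.norm_nth_le)
qed

lemma norm_geometric_vec_unimodular:
  assumes "cmod z = 1"
  shows "norm (geometric_vec z y :: 'a::complex_inner ^ ('n::{finite,linorder})) = sqrt CARD('n::{finite,linorder}) * norm y"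
  using assms
  by (simp add: norm_vec_def L2_set_def geometric_vec_def norm_scaleC norm_power real_sqrt_mult)

lemma invertible_bound_of_J_op:
  fixes T :: "'a::complex_inner \<Rightarrow> 'a"
  assumes J: "invertible_bound c (\<lambda>v :: 'a ^ ('n::{finite,linorder}). J_op T v - z *\<^sub>C v)"
  shows "invertible_bound c (\<lambda>x. T x - z ^ CARD('n) *\<^sub>C x)"
proof -
  have "surj (\<lambda>x. T x - z ^ CARD('n) *\<^sub>C x)"
    using J by (intro surj_of_J_op_shift) (simp add: invertible_bound_def)
  then show ?thesis
    using J order_trans[OF norm_geometric_vec_ge norm_geometric_vec_bound[OF J]]
    by (simp add: invertible_bound_def)
qed

text \<open>For unimodular \<open>z\<close> all n coordinates of the geometric vector have norm
  \<open>norm y\<close>, which gains the factor sqrt n.\<close>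

lemma invertible_bound_of_J_op_unimodular:
  fixes T :: "'a::complex_inner \<Rightarrow> 'a"
  assumes J: "invertible_bound c (\<lambda>v :: 'a ^ ('n::{finite,linorder}). J_op T v - z *\<^sub>C v)"
    and z: "cmod z = 1"
  shows "invertible_bound (c / sqrt CARD('n)) (\<lambda>x. T x - z ^ CARD('n) *\<^sub>C x)"
proof -
  have "norm y \<le> c / sqrt CARD('n) * norm (T y - z ^ CARD('n) *\<^sub>C y)" for y
    using norm_geometric_vec_bound[OF J, of y]
    by (simp add: norm_geometric_vec_unimodular[OF z] field_simps)
  moreover have "surj (\<lambda>x. T x - z ^ CARD('n) *\<^sub>C x)"
    using J by (intro surj_of_J_op_shift) (simp add: invertible_bound_def)
  ultimately show ?thesis
    using J by (simp add: invertible_bound_def)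
qed

section \<open>From invertibility of T - z^n back to that of J - z\<close>

lemma surj_J_op_shift:
  fixes T :: "'a::complex_inner \<Rightarrow> 'a"
  assumes T: "surj (\<lambda>x. T x - z ^ CARD('n) *\<^sub>C x)"
  shows "surj (\<lambda>v :: 'a ^ ('n::{finite,linorder}). J_op T v - z *\<^sub>C v)"
  unfolding surj_def
proof (rule allI)
  fix w :: "('a, 'n) vec"
  let ?n = "CARD('n)"
  have n: "1 \<le> ?n" by (simp add: Suc_leI)
  \<comment> \<open>The rows before the last are a recursion for the coordinates; \<open>g k\<close>
    is coordinate k + 1 of its solution with first coordinate 0.\<close>
  define g where "g = rec_nat 0 (\<lambda>k u. z *\<^sub>C u + w $ index_at (Suc k))"
  have g: "g 0 = 0" "\<And>k. g (Suc k) = z *\<^sub>C g k + w $ index_at (Suc k)"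
    by (simp_all add: g_def)
  \<comment> \<open>The free first coordinate \<open>a\<close> is fixed by the last row, after
    inserting z^(n-1) a + g (n-1) for the last coordinate.\<close>
  obtain a where a: "T a - z ^ ?n *\<^sub>C a = w $ index_at ?n + z *\<^sub>C g (?n - 1)"
    using surjD[OF T, of "w $ index_at ?n + z *\<^sub>C g (?n - 1)"] by metis
  define v :: "('a, 'n) vec" where "v = (\<chi> i. z ^ (index_pos i - 1) *\<^sub>C a + g (index_pos i - 1))"
  have v: "v $ index_at (Suc k) = z ^ k *\<^sub>C a + g k" if "Suc k \<le> ?n" for k
    using that by (simp add: v_def index_pos_index_at)
  have "w = J_op T v - z *\<^sub>C v"
  proof (rule vec_eq_index_atI)
    fix k assume k: "1 \<le> k" "k \<le> ?n"
    then obtain m where m: "k = Suc m" by (cases k) auto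
    show "w $ index_at k = (J_op T v - z *\<^sub>C v) $ index_at k"
    proof (cases "k = ?n")
      case True
      have "v $ index_at 1 = a" using v[of 0] n by (simp add: g scaleC_one)
      moreover have "?n - 1 = m" "z * z ^ m = z ^ ?n"
        using True m by (simp_all flip: power_Suc)
      ultimately show ?thesis
        using a v[of m] True m J_op_nth_last[of T v]
        by (simp add: scaleC_vec_def scaleC_add_right scaleC_scaleC algebra_simps)
    next
      case False
      then show ?thesis
        using k m v[of m] v[of "Suc m"]
        by (simp add: J_op_nth_less scaleC_vec_def g scaleC_add_right scaleC_scaleC)
    qed
  qed
  then show "\<exists>v. w = J_op T v - z *\<^sub>C v" by blast
qed

text \<open>By the recursion, each coordinate differs from a power of \<open>z\<close> times the
  first by an amount controlled by the image. The last row and the bound for T - z^n then control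
  the first coordinate, hence all of them. Only the existence of a constant matters in this
  direction.\<close>

lemma J_op_shift_bounded_below:
  fixes T :: "'a::complex_inner \<Rightarrow> 'a"
  assumes T: "bounded_clinear T" and c: "invertible_bound c (\<lambda>x. T x - z ^ CARD('n) *\<^sub>C x)"
  shows "\<exists>C>0. \<forall>v :: 'a ^ ('n::{finite,linorder}). norm v \<le> C * norm (J_op T v - z *\<^sub>C v)"
proof -
  let ?n = "CARD('n)"
  let ?w = "\<lambda>v :: ('a, 'n) vec. J_op T v - z *\<^sub>C v"
  have n: "1 \<le> ?n" by (simp add: Suc_leI)
  have dev: "Suc k \<le> ?n \<Longrightarrow> \<exists>C. \<forall>v. norm (v $ index_at (Suc k) - z ^ k *\<^sub>C (v $ index_at 1)) \<le> C * norm (?w v)"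
    for k
  proof (induction k)
    case 0
    show ?case by (rule exI[of _ 0]) (simp add: scaleC_one)
  next
    case (Suc k)
    then obtain C where
      C: "\<And>v. norm (v $ index_at (Suc k) - z ^ k *\<^sub>C (v $ index_at 1)) \<le> C * norm (?w v)"
      by auto
    have "norm (v $ index_at (Suc (Suc k)) - z ^ Suc k *\<^sub>C (v $ index_at 1)) \<le> (cmod z * C + 1) * norm (?w v)"
      for v
    proof -
      have "v $ index_at (Suc (Suc k)) - z ^ Suc k *\<^sub>C (v $ index_at 1) =
          z *\<^sub>C (v $ index_at (Suc k) - z ^ k *\<^sub>C (v $ index_at 1)) + ?w v $ index_at (Suc k)"
        using Suc.prems
        by (simp add: J_op_nth_less scaleC_vec_def complex_vector.scale_right_diff_distrib scaleC_scaleC)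
      also have "norm \<dots> \<le> cmod z * (C * norm (?w v)) + norm (?w v)"
        by (intro norm_triangle_mono Finite_Cartesian_Product.norm_nth_le)
          (simp only: norm_scaleC, intro mult_left_mono C norm_ge_zero)
      finally show ?thesis by (simp add: algebra_simps)
    qed
    then show ?case by blast
  qed
  obtain D where
    D: "\<And>v. norm (v $ index_at ?n - z ^ (?n - 1) *\<^sub>C (v $ index_at 1)) \<le> D * norm (?w v)"
    using dev[of "?n - 1"] n by auto
  from c have c0: "c > 0" and low: "\<And>x. norm x \<le> c * norm (T x - z ^ ?n *\<^sub>C x)"
    unfolding invertible_bound_def by blast+
  have first: "norm (v $ index_at 1) \<le> c * (cmod z * D + 1) * norm (?w v)" for v
  proof -
    have pw: "z * z ^ (?n - 1) = z ^ ?n"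
      using n by (metis One_nat_def Suc_le_lessD power_minus_mult mult.commute)
    have "norm (v $ index_at 1) \<le> c * norm (T (v $ index_at 1) - z ^ ?n *\<^sub>C (v $ index_at 1))"
      by (rule low)
    also have "T (v $ index_at 1) - z ^ ?n *\<^sub>C (v $ index_at 1) =
        z *\<^sub>C (v $ index_at ?n - z ^ (?n - 1) *\<^sub>C (v $ index_at 1)) + ?w v $ index_at ?n"
      using n
      by (simp add: J_op_nth_last scaleC_vec_def complex_vector.scale_right_diff_distrib scaleC_scaleC pw[simplified])
    also have "norm \<dots> \<le> cmod z * (D * norm (?w v)) + norm (?w v)"
      by (intro norm_triangle_mono Finite_Cartesian_Product.norm_nth_le)
        (simp only: norm_scaleC, intro mult_left_mono D norm_ge_zero)
    finally show ?thesis
      using c0 by (simp add: algebra_simps)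
  qed
  have "\<exists>C. \<forall>v. norm (v $ i) \<le> C * norm (?w v)" for i
  proof -
    obtain k where k: "index_pos i = Suc k" "Suc k \<le> ?n"
      using index_pos_bounds[of i] by (cases "index_pos i") auto
    then obtain C where C: "\<And>v. norm (v $ i - z ^ k *\<^sub>C (v $ index_at 1)) \<le> C * norm (?w v)"
      using dev[of k] index_at_index_pos[of i] by auto
    have "norm (v $ i) \<le> (C + cmod z ^ k * (c * (cmod z * D + 1))) * norm (?w v)" for v
    proof -
      have "norm (v $ i) \<le> norm (v $ i - z ^ k *\<^sub>C (v $ index_at 1)) + norm (z ^ k *\<^sub>C (v $ index_at 1))"
        by (metis diff_add_cancel norm_triangle_ineq)
      also have "\<dots> \<le> C * norm (?w v) + cmod z ^ k * (c * (cmod z * D + 1) * norm (?w v))"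
        unfolding norm_scaleC norm_power by (intro add_mono C mult_left_mono first) simp
      finally show ?thesis by (simp add: algebra_simps)
    qed
    then show ?thesis by blast
  qed
  then obtain C where C: "\<And>i v. norm (v $ i) \<le> C i * norm (?w v)"
    by metis
  \<comment> \<open>The constants \<open>C i\<close> have no known sign; the absolute value and the
    1 make the final constant positive.\<close>
  have "norm v \<le> (1 + \<bar>\<Sum>i\<in>UNIV. C i\<bar>) * norm (?w v)" for v
  proof -
    have "norm v \<le> (\<Sum>i\<in>UNIV. norm (v $ i))"
      unfolding norm_vec_def by (rule L2_set_le_sum) simp
    also have "\<dots> \<le> (\<Sum>i\<in>UNIV. C i * norm (?w v))"
      by (intro sum_mono C)
    also have "\<dots> = (\<Sum>i\<in>UNIV. C i) * norm (?w v)"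
      by (simp add: sum_distrib_right)
    also have "\<dots> \<le> (1 + \<bar>\<Sum>i\<in>UNIV. C i\<bar>) * norm (?w v)"
      by (intro mult_right_mono) auto
    finally show ?thesis .
  qed
  then show ?thesis
    by (intro exI[of _ "1 + \<bar>\<Sum>i\<in>UNIV. C i\<bar>"]) auto
qed


section \<open>The spectrum of a stable operator\<close>

text \<open>Quantitative openness of the resolvent set: a bound \<open>c\<close> at \<open>a\<close>
  clears the disc of radius 1/c about \<open>a\<close>.\<close>

lemma shift_invertible_bound_perturb:
  fixes T :: "'h::chilbert_space \<Rightarrow> 'h"
  assumes T: "bounded_clinear T" and c: "invertible_bound c (\<lambda>x. T x - a *\<^sub>C x)"
    and close: "c * cmod (b - a) < 1"
  shows "invertible_bound (c / (1 - c * cmod (b - a))) (\<lambda>x. T x - b *\<^sub>C x)"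
proof (rule invertible_bound_perturb[OF c])
  show "linear (\<lambda>x. T x - a *\<^sub>C x)" "linear (\<lambda>x. T x - b *\<^sub>C x)"
    by (intro bounded_linear.linear bounded_clinear_imp_bounded_linear bounded_clinear_shift T)+
  show "norm ((T x - a *\<^sub>C x) - (T x - b *\<^sub>C x)) \<le> cmod (b - a) * norm x" for x
    by (simp add: complex_vector.scale_left_diff_distrib[symmetric] norm_scaleC)
qed (use close in auto)

text \<open>For large \<open>z\<close> the operator T - z is a perturbation by \<open>T\<close> of
  multiplication by -z, whose inverse has norm at most 1/|z|.\<close>

lemma shift_invertible_bound_large:
  fixes T :: "'h::chilbert_space \<Rightarrow> 'h"
  assumes T: "bounded_clinear T"
  shows "\<exists>R. \<forall>z. cmod z > R \<longrightarrow> (\<exists>c. invertible_bound c (\<lambda>x. T x - z *\<^sub>C x))"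
proof -
  obtain K where K: "K > 0" "\<And>x. norm (T x) \<le> norm x * K"
    using bounded_linear.pos_bounded[OF bounded_clinear_imp_bounded_linear[OF T]] by blast
  have "\<exists>c. invertible_bound c (\<lambda>x. T x - z *\<^sub>C x)" if z: "cmod z > K" for z
  proof -
    have z0: "z \<noteq> 0" using z K(1) by auto
    let ?S = "\<lambda>x :: 'h. - (z *\<^sub>C x)"
    have lin: "linear ?S"
      by (intro linear_compose_neg bounded_linear.linear bounded_clinear_imp_bounded_linear
          bounded_clinear_scaleC)
    have "x = ?S (- (inverse z *\<^sub>C x))" for x
      using z0 by (simp add: scaleC_scaleC scaleC_one)
    then have "surj ?S" by (metis surj_def)
    then have "invertible_bound (1 / cmod z) ?S"
      using z0 by (simp add: invertible_bound_def norm_scaleC)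
    then have "invertible_bound (1 / cmod z / (1 - 1 / cmod z * K)) (\<lambda>x. T x - z *\<^sub>C x)"
    proof (rule invertible_bound_perturb[OF _ lin])
      show "linear (\<lambda>x. T x - z *\<^sub>C x)"
        by (intro bounded_linear.linear bounded_clinear_imp_bounded_linear bounded_clinear_shift T)
      show "norm (?S x - (T x - z *\<^sub>C x)) \<le> K * norm x" for x
        using K(2)[of x] by (simp add: mult.commute)
      show "0 \<le> K" "1 / cmod z * K < 1"
        using K(1) z by (auto simp: divide_simps)
    qed
    then show ?thesis by blast
  qed
  then show ?thesis by blast
qed

theorem proposition2p11:
  fixes T :: "'h::chilbert_space \<Rightarrow> 'h"
  assumes "separable_space (euclidean :: 'h topology)"
    and "\<not> (\<exists>B :: 'h set. finite B \<and> complex_vector.span B = UNIV)"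
    and "bounded_clinear T"
    and "CARD('n::{finite,linorder}) \<ge> 2"
    and "approx_unitarily_equiv T (J_op T :: 'h ^ ('n::{finite,linorder}) \<Rightarrow> 'h ^ ('n::{finite,linorder}))"
  shows "(invertible_op T \<longrightarrow> op_spectrum T = sphere 0 1) \<and>
         (\<not> invertible_op T \<longrightarrow> op_spectrum T = closure (ball 0 1))"
proof -
  let ?n = "CARD('n)"
  let ?J = "J_op T :: ('h, 'n) vec \<Rightarrow> ('h, 'n) vec"
  let ?res = "\<lambda>c z. invertible_bound c (\<lambda>x. T x - z *\<^sub>C x)"
  note T = assms(3) and n = assms(4)
  have spec: "z \<in> op_spectrum T \<longleftrightarrow> \<not> (\<exists>c. ?res c z)" for z
    by (simp add: op_spectrum_def invertible_op_iff_bound bounded_clinear_shift T)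
  have inv0: "invertible_op T \<longleftrightarrow> (\<exists>c. ?res c 0)"
    by (simp add: invertible_op_iff_bound T)
  have linT: "linear (\<lambda>x. T x - z *\<^sub>C x)" and linJ: "linear (\<lambda>v. ?J v - z *\<^sub>C v)" for z
    by (intro bounded_linear.linear bounded_clinear_imp_bounded_linear bounded_clinear_shift
        bounded_clinear_J_op T)+
  have TJ: "almost_intertwined (\<lambda>x. T x - z *\<^sub>C x) (\<lambda>v. ?J v - z *\<^sub>C v)" for z
    by (rule approx_unitarily_equiv_imp_almost_intertwined[OF assms(5) T bounded_clinear_J_op[OF T]])
  have res_J: "invertible_bound c (\<lambda>v. ?J v - z *\<^sub>C v)" if "?res c z" for c z
    by (rule invertible_bound_intertwined[OF TJ linT linJ that])
  \<comment> \<open>Each step passes from \<open>T\<close> to J by stability and from J at a point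
    back to \<open>T\<close> at its n-th power, with the same constant.\<close>
  have up: "?res c (z ^ (?n ^ k))" if "?res c z" for c z k
  proof (induction k)
    case (Suc k)
    show ?case
      using invertible_bound_of_J_op[OF res_J[OF Suc.IH]]
      by (simp add: power_mult[symmetric] mult.commute)
  qed (use that in simp)
  \<comment> \<open>Powers stay on the unit circle, so every step divides the constant by sqrt
    n.\<close>
  have up_circle: "?res (c / sqrt ?n ^ k) (z ^ (?n ^ k))" if "?res c z" "cmod z = 1" for c z k
  proof (induction k)
    case (Suc k)
    have "cmod (z ^ (?n ^ k)) = 1" using that(2) by (simp add: norm_power)
    then show ?case
      using invertible_bound_of_J_op_unimodular[OF res_J[OF Suc.IH]]
      by (simp add: power_mult[symmetric] mult.commute)
  qed (use that in simp)
  \<comment> \<open>The reverse passage, taking n-th roots one level at a time; the constants are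
    not tracked.\<close>
  have down: "\<exists>c. ?res c z" if "\<exists>c. ?res c (z ^ (?n ^ k))" for z k
    using that
  proof (induction k)
    case (Suc k)
    then obtain c where c: "?res c ((z ^ (?n ^ k)) ^ ?n)"
      by (auto simp: power_mult[symmetric] mult.commute)
    let ?u = "z ^ (?n ^ k)"
    obtain C where "C > 0" "\<And>v :: ('h, 'n) vec. norm v \<le> C * norm (?J v - ?u *\<^sub>C v)"
      using J_op_shift_bounded_below[OF T c] by blast
    moreover have "surj (\<lambda>v. ?J v - ?u *\<^sub>C v)"
      using c by (intro surj_J_op_shift) (simp add: invertible_bound_def)
    ultimately have "invertible_bound C (\<lambda>v. ?J v - ?u *\<^sub>C v)"
      by (simp add: invertible_bound_def)
    then have "?res C ?u"
      by (rule invertible_bound_intertwined[OF almost_intertwined_sym[OF TJ] linJ linT])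
    then show ?case using Suc.IH by blast
  qed simp
  have nk: "filterlim (\<lambda>k. ?n ^ k) at_top sequentially"
    using n by (intro filterlim_subseq) (simp add: strict_mono_def power_strict_increasing)
  have near0: "\<exists>k. c * cmod (z ^ (?n ^ k)) < 1" if "cmod z < 1" for c z
  proof -
    have "(\<lambda>k. z ^ (?n ^ k)) \<longlonglongrightarrow> 0"
      by (rule filterlim_compose[OF LIMSEQ_power_zero[OF that] nk])
    then have "(\<lambda>k. c * cmod (z ^ (?n ^ k))) \<longlonglongrightarrow> c * 0"
      by (intro tendsto_mult tendsto_const tendsto_norm_zero)
    then have "\<forall>\<^sub>F k in sequentially. c * cmod (z ^ (?n ^ k)) < 1"
      by (rule order_tendstoD) simp
    then show ?thesis unfolding eventually_sequentially by blast
  qed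

  have circle: "z \<in> op_spectrum T" if z: "cmod z = 1" for z
  proof (rule ccontr)
    assume "z \<notin> op_spectrum T"
    then obtain c where c: "?res c z" by (auto simp: spec)
    obtain K where K: "K > 0" "\<And>x. norm (T x) \<le> norm x * K"
      using bounded_linear.pos_bounded[OF bounded_clinear_imp_bounded_linear[OF T]] by blast
    \<comment> \<open>Infinite dimension is applied to the empty set to obtain a nonzero
      vector.\<close>
    have "complex_vector.span {} \<noteq> (UNIV :: 'h set)"
      using assms(2) by blast
    then obtain x :: 'h where x: "x \<noteq> 0" by auto
    \<comment> \<open>The shrinking resolvent bound meets the upper bound \<open>K + 1\<close> for
      the norm of \<open>T\<close> minus a unimodular scalar; this would bound the powers of sqrt
      n.\<close>
    have "sqrt ?n ^ k \<le> c * (K + 1)" for k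
    proof -
      have c0: "c > 0" using c by (simp add: invertible_bound_def)
      let ?w = "z ^ (?n ^ k)"
      have "norm (T x - ?w *\<^sub>C x) \<le> norm (T x) + norm (?w *\<^sub>C x)"
        by (rule norm_triangle_ineq4)
      also have "\<dots> \<le> (K + 1) * norm x"
        using K(2)[of x] z by (simp add: norm_scaleC norm_power algebra_simps)
      finally have "c / sqrt ?n ^ k * norm (T x - ?w *\<^sub>C x) \<le> c / sqrt ?n ^ k * ((K + 1) * norm x)"
        using c0 by (intro mult_left_mono) auto
      moreover have "norm x \<le> c / sqrt ?n ^ k * norm (T x - ?w *\<^sub>C x)"
        using up_circle[OF c z, of k] unfolding invertible_bound_def by blast
      ultimately have "norm x \<le> c / sqrt ?n ^ k * ((K + 1) * norm x)"
        by (rule order_trans[rotated])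
      then have "norm x * sqrt ?n ^ k \<le> norm x * (c * (K + 1))"
        by (simp add: pos_le_divide_eq mult_ac)
      then show ?thesis
        using x by (simp add: mult_le_cancel_left_pos)
    qed
    moreover have "1 < sqrt ?n" using n by simp
    ultimately show False
      by (metis not_less real_arch_pow)
  qed
  have outside: "z \<notin> op_spectrum T" if z: "cmod z > 1" for z
  proof -
    obtain R where R: "\<And>w. cmod w > R \<Longrightarrow> \<exists>c. ?res c w"
      using shift_invertible_bound_large[OF T] by blast
    \<comment> \<open>The power found need not have an exponent of the form n^k; since m \<le> n^m,
      enlarging the exponent to n^m keeps the point outside radius \<open>R\<close>.\<close>
    obtain m where "R < cmod z ^ m" using real_arch_pow[OF z] by blast
    also have "m \<le> ?n ^ m"
      using n self_le_ge2_pow by blast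
    then have "cmod z ^ m \<le> cmod z ^ (?n ^ m)"
      using z by (intro power_increasing) auto
    finally have "\<exists>c. ?res c (z ^ (?n ^ m))"
      by (intro R) (simp add: norm_power)
    then show ?thesis using down spec by blast
  qed
  have inside: "z \<notin> op_spectrum T \<longleftrightarrow> invertible_op T" if z: "cmod z < 1" for z
  proof
    assume "z \<notin> op_spectrum T"
    then obtain c where c: "?res c z" by (auto simp: spec)
    \<comment> \<open>The constant \<open>c\<close> is inherited by the iterates of
      \<open>z\<close>, so once an iterate is closer to 0 than 1/c, the point 0 is in the resolvent
      set.\<close>
    obtain k where "c * cmod (z ^ (?n ^ k)) < 1" using near0[OF z] by blast
    then have "c * cmod (0 - z ^ (?n ^ k)) < 1" by simp
    then show "invertible_op T"
      unfolding inv0 using shift_invertible_bound_perturb[OF T up[OF c]] by blast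
  next
    assume "invertible_op T"
    then obtain c where c: "?res c 0" by (auto simp: inv0)
    \<comment> \<open>Now the disc of radius 1/c about 0 lies in the resolvent set; it contains an
      iterate of \<open>z\<close>, and \<open>down\<close> leads back to \<open>z\<close>.\<close>
    obtain k where "c * cmod (z ^ (?n ^ k)) < 1" using near0[OF z] by blast
    then have "c * cmod (z ^ (?n ^ k) - 0) < 1" by simp
    then show "z \<notin> op_spectrum T"
      using shift_invertible_bound_perturb[OF T c] down spec by blast
  qed
  have eq: "z \<in> op_spectrum T \<longleftrightarrow> cmod z = 1 \<or> cmod z < 1 \<and> \<not> invertible_op T" for z
    using circle[of z] outside[of z] inside[of z]
    by (cases "cmod z" "1 :: real" rule: linorder_cases) (simp_all, blast)
  have "op_spectrum T = sphere 0 1" if "invertible_op T"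
    using that by (intro set_eqI) (simp add: eq)
  moreover have "op_spectrum T = cball 0 1" if "\<not> invertible_op T"
    using that by (intro set_eqI) (simp add: eq le_less disj_commute)
  ultimately show ?thesis by simp
qed

end
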